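(* Let $r\ge 1$ be an integer. The set of Dyck paths of height $2$ with exactly $r$ peaks of height $1$ and exactly $r$ peaks of height $2$ is in bijection with the set of $(r+1)$-tuples of integer compositions (where the composition of $0$, i.e. the empty composition, is allowed as an entry) with grand total sum $r$. Both sets have cardinality $(r+1)s_r$, where $s_r$ is the number of little Schröder paths of semi-length $r$.
   Context: A Dyck path is a lattice path starting at $(0,0)$ and ending on the $x$-axis, with steps $\mathtt{u}=(1,1)$ and $\mathtt{d}=(1,-1)$, that never goes below the $x$-axis; its height is the maximal ordinate reached. A peak is an occurrence of consecutive steps $\mathtt{u}\mathtt{d}$; its height is the ordinate at which its $\mathtt{u}$ step ends. The length of the Dyck paths is not fixed in the statement. An integer composition of $m\ge 1$ is a finite sequence of positive integers with sum $m$; there is exactly one composition of $0$. The grand total sum of a tuple of compositions is the sum of all parts of all its entries. A little Schröder path of semi-length $n$ is a lattice path from $(0,0)$ to $(2n,0)$ with steps $\mathtt{u}=(1,1)$, $\mathtt{d}=(1,-1)$ and $\mathtt{h}_2=(2,0)$ that always stays weakly above the $x$-axis and has no $\mathtt{h}_2$ step at height zero. *)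

theory Defs
  imports Main
begin

(* Dyck paths only use the steps U and D; Schroeder paths also use the
   horizontal step H2 = (2,0).  A path is the list of its steps, starting at (0,0). *)
datatype step = U | D | H2

fun step_dx :: "step \<Rightarrow> int" where
  "step_dx U = 1"
| "step_dx D = 1"
| "step_dx H2 = 2"

fun step_dy :: "step \<Rightarrow> int" where
  "step_dy U = 1"
| "step_dy D = -1"
| "step_dy H2 = 0"

(* Coordinates of the lattice point reached after the first i steps. *)
definition abscissa :: "step list \<Rightarrow> nat \<Rightarrow> int" where
  "abscissa p i = sum_list (map step_dx (take i p))"

definition ordinate :: "step list \<Rightarrow> nat \<Rightarrow> int" where
  "ordinate p i = sum_list (map step_dy (take i p))"

(* Ordinates are affine along each step, so nonnegativity at the lattice points
   reached after each step says that the whole path stays weakly above the axis. *)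
definition weakly_above_axis :: "step list \<Rightarrow> bool" where
  "weakly_above_axis p \<longleftrightarrow> (\<forall>i\<le>length p. 0 \<le> ordinate p i)"

definition dyck_path :: "step list \<Rightarrow> bool" where
  "dyck_path p \<longleftrightarrow>
     set p \<subseteq> {U, D} \<and> weakly_above_axis p \<and> ordinate p (length p) = 0"

definition path_height :: "step list \<Rightarrow> int" where
  "path_height p = Max (ordinate p ` {..length p})"

(* A peak is recorded by the index of its U step; its height is the ordinate
   after that step. *)
definition peaks_at :: "int \<Rightarrow> step list \<Rightarrow> nat set" where
  "peaks_at h p =
     {i. Suc i < length p \<and> p ! i = U \<and> p ! Suc i = D \<and> ordinate p (Suc i) = h}"

definition dyck_paths_height2 :: "nat \<Rightarrow> step list set" where
  "dyck_paths_height2 r =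
     {p. dyck_path p \<and> path_height p = 2 \<and> card (peaks_at 1 p) = r \<and> card (peaks_at 2 p) = r}"

(* The empty list is the unique composition of 0. *)
definition is_composition :: "nat list \<Rightarrow> nat \<Rightarrow> bool" where
  "is_composition c m \<longleftrightarrow> (\<forall>x\<in>set c. 0 < x) \<and> sum_list c = m"

definition composition_tuples :: "nat \<Rightarrow> nat \<Rightarrow> nat list list set" where
  "composition_tuples k n =
     {t. length t = k \<and> (\<forall>c\<in>set t. \<exists>m. is_composition c m) \<and> sum_list (map sum_list t) = n}"

definition little_schroeder_paths :: "nat \<Rightarrow> step list set" where
  "little_schroeder_paths n =
     {p. weakly_above_axis p \<and>
         abscissa p (length p) = 2 * int n \<and> ordinate p (length p) = 0 \<and>
         (\<forall>i<length p. p ! i = H2 \<longrightarrow> ordinate p i \<noteq> 0)}"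

lemma length_le_abscissa: "int (length p) \<le> abscissa p (length p)"
proof -
  have "int (length p) \<le> sum_list (map step_dx p)"
  proof (induction p)
    case (Cons a p)
    then show ?case by (cases a) auto
  qed simp
  then show ?thesis by (simp add: abscissa_def)
qed

lemma finite_little_schroeder_paths: "finite (little_schroeder_paths n)"
proof (rule finite_subset)
  have "finite (UNIV :: step set)"
    by (rule finite_subset[of _ "{U, D, H2}"]) (use step.exhaust in auto)
  then show "finite {p. set p \<subseteq> (UNIV :: step set) \<and> length p \<le> 2 * n}"
    by (rule finite_lists_length_le)
  show "little_schroeder_paths n \<subseteq> {p. set p \<subseteq> UNIV \<and> length p \<le> 2 * n}"
  proof
    fix p assume "p \<in> little_schroeder_paths n"
    then have "abscissa p (length p) = 2 * int n"
      by (simp add: little_schroeder_paths_def)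
    with length_le_abscissa[of p] show "p \<in> {p. set p \<subseteq> UNIV \<and> length p \<le> 2 * n}"
      by simp
  qed
qed

definition little_schroeder_number :: "nat \<Rightarrow> nat" where
  "little_schroeder_number n = card (little_schroeder_paths n)"

end

(* A Dyck path of height at most 2 is a sequence of components U (U D)^k D, so it is a word in the
   numbers k whose zeros are the peaks of height 1 and whose sum counts the peaks of height 2.
   Splitting the word at its r zeros gives r + 1 compositions with total sum r.

   If C(x) = (1 - x) / (1 - 2 x) generates compositions, the number of such tuples is the coefficient
   of x^r in C^(r+1).  First-return decomposition gives S = 1 + x L S and L = 1 + x L + x L^2 for
   the little and large Schroeder series, hence L = 2 S - 1 and S = C(x S).  Lagrange inversion then
   says that this coefficient is (r + 1) s_r. *)
theory Submission
  imports Defs "HOL-Computational_Algebra.Formal_Power_Series"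
begin

unbundle fps_syntax

section \<open>Lagrange inversion\<close>

text \<open>Both sides are k (n + k) f' f^(n+k-1). The factor n + k stands in for a division, and k
  = 0 is split off because the exponent k - 1 is truncated there.\<close>

lemma fps_deriv_power_mult_power:
  fixes f :: "'a :: field_char_0 fps"
  shows "of_nat (n + k) * (fps_deriv (f ^ k) * f ^ n) = of_nat k * fps_deriv (f ^ (n + k))"
proof (cases k)
  case (Suc m)
  then show ?thesis
    by (simp only: fps_deriv_power' add_Suc_right diff_Suc_1 power_add mult_ac)
qed simp

lemma fps_of_nat_mult_nth:
  fixes f :: "'a :: comm_ring_1 fps"
  shows "(of_nat c * f) $ n = of_nat c * f $ n"
  by (simp add: fps_of_nat[symmetric])

text \<open>Strong induction on n. The coefficient of x^n in g^k = f^k(x g) combines the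
  coefficients of x^(n-i) in g^i, which the hypothesis supplies for i > 0. What results is the
  coefficient of x^n in x (f^k)' f^n, and (n + k) (f^k)' f^n = k (f^(n+k))'.\<close>

lemma lagrange_inversion:
  fixes f g :: "'a :: field_char_0 fps"
  assumes g: "g = fps_compose f (fps_X * g)"
  shows "of_nat (n + k) * (g ^ k $ n) = of_nat k * (f ^ (n + k) $ n)"
proof (induction n arbitrary: k rule: less_induct)
  case (less n)
  have "g ^ k = fps_compose f (fps_X * g) ^ k"
    using g by simp
  also have "\<dots> = fps_compose (f ^ k) (fps_X * g)"
    by (subst fps_compose_power) simp_all
  finally have gk: "g ^ k = fps_compose (f ^ k) (fps_X * g)" .
  show ?case
  proof (cases "n = 0")
    case True
    then show ?thesis
      using gk by (simp add: fps_compose_nth)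
  next
    case False
    \<comment> \<open>The indices n - i and i add up to n, so all instances share the factor n and
      the power \<open>f ^ n\<close>. The term i = 0 vanishes on both sides since n > 0.\<close>
    have IH: "of_nat n * (f ^ k $ i * ((fps_X * g) ^ i $ n)) = (of_nat i * f ^ k $ i) * (f ^ n $ (n - i))"
      if "i \<le> n" for i
    proof (cases "i = 0")
      case True
      then show ?thesis using False by simp
    next
      case i: False
      have "of_nat n * (g ^ i $ (n - i)) = of_nat i * (f ^ n $ (n - i))"
        using less.IH[of "n - i" i] that i False by simp
      then show ?thesis
        using that by (simp add: power_mult_distrib fps_X_power_mult_nth algebra_simps)
    qed
    have "of_nat n * (g ^ k $ n) = (\<Sum>i=0..n. (of_nat i * f ^ k $ i) * (f ^ n $ (n - i)))"
      unfolding gk fps_compose_nth sum_distrib_left by (intro sum.cong IH) auto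
    also have "\<dots> = (fps_X * fps_deriv (f ^ k) * f ^ n) $ n"
      unfolding fps_mult_nth[of "fps_X * fps_deriv (f ^ k)"]
      by (intro sum.cong refl) (auto simp: of_nat_Suc[symmetric] simp del: of_nat_Suc)
    finally have "of_nat (n + k) * (of_nat n * (g ^ k $ n)) =
        of_nat (n + k) * ((fps_X * fps_deriv (f ^ k) * f ^ n) $ n)"
      by (rule arg_cong)
    also have "\<dots> = (fps_X * (of_nat (n + k) * (fps_deriv (f ^ k) * f ^ n))) $ n"
      unfolding fps_of_nat_mult_nth[symmetric] by (simp only: mult_ac)
    also have "\<dots> = of_nat k * ((fps_X * fps_deriv (f ^ (n + k))) $ n)"
      unfolding fps_deriv_power_mult_power fps_of_nat_mult_nth[symmetric] by (simp only: mult_ac)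
    also have "\<dots> = of_nat n * (of_nat k * (f ^ (n + k) $ n))"
      using False by simp
    finally have "of_nat n * (of_nat (n + k) * (g ^ k $ n)) = of_nat n * (of_nat k * (f ^ (n + k) $ n))"
      by (simp only: mult.left_commute)
    then show ?thesis
      using False by simp
  qed
qed

section \<open>Generating functions of graded sets\<close>

text \<open>\<open>card\<close> is 0 on infinite sets, so the sum and product rules for series are
  stated for finite levels.\<close>

definition graded_finite :: "'a set \<Rightarrow> ('a \<Rightarrow> nat) \<Rightarrow> bool" where
  "graded_finite A w \<longleftrightarrow> (\<forall>n. finite {a \<in> A. w a = n})"

definition gen_fun :: "'a set \<Rightarrow> ('a \<Rightarrow> nat) \<Rightarrow> rat fps" where
  "gen_fun A w = Abs_fps (\<lambda>n. of_nat (card {a \<in> A. w a = n}))"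

lemma gen_fun_nth [simp]: "gen_fun A w $ n = of_nat (card {a \<in> A. w a = n})"
  by (simp add: gen_fun_def)

lemma gen_fun_image:
  assumes "inj_on f A" and "\<And>a. a \<in> A \<Longrightarrow> w (f a) = v a"
  shows "gen_fun (f ` A) w = gen_fun A v"
proof (rule fps_ext)
  fix n
  have "{b \<in> f ` A. w b = n} = f ` {a \<in> A. v a = n}"
    using assms(2) by auto
  moreover have "inj_on f {a \<in> A. v a = n}"
    using assms(1) by (rule inj_on_subset) auto
  ultimately show "gen_fun (f ` A) w $ n = gen_fun A v $ n"
    by (simp add: card_image)
qed

lemma graded_finite_image:
  assumes "graded_finite A v" and "\<And>a. a \<in> A \<Longrightarrow> w (f a) = v a"
  shows "graded_finite (f ` A) w"
  unfolding graded_finite_def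
proof
  fix n
  have "{b \<in> f ` A. w b = n} = f ` {a \<in> A. v a = n}"
    using assms(2) by auto
  then show "finite {b \<in> f ` A. w b = n}"
    using assms(1) by (simp add: graded_finite_def)
qed

lemma gen_fun_Un:
  assumes "graded_finite A w" and "graded_finite B w" and "A \<inter> B = {}"
  shows "gen_fun (A \<union> B) w = gen_fun A w + gen_fun B w"
proof (rule fps_ext)
  fix n
  have "{a \<in> A \<union> B. w a = n} = {a \<in> A. w a = n} \<union> {a \<in> B. w a = n}"
    by auto
  then show "gen_fun (A \<union> B) w $ n = (gen_fun A w + gen_fun B w) $ n"
    using assms by (simp add: graded_finite_def card_Un_disjoint disjoint_iff)
qed

lemma gen_fun_singleton: "w a = 0 \<Longrightarrow> gen_fun {a} w = 1"
proof (rule fps_ext)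
  fix n assume "w a = 0"
  then have "{x \<in> {a}. w x = n} = (if n = 0 then {a} else {})"
    by auto
  then show "gen_fun {a} w $ n = 1 $ n"
    by simp
qed

lemma gen_fun_Suc: "gen_fun A (\<lambda>a. Suc (w a)) = fps_X * gen_fun A w"
proof (rule fps_ext)
  fix n show "gen_fun A (\<lambda>a. Suc (w a)) $ n = (fps_X * gen_fun A w) $ n"
    by (cases n) auto
qed

text \<open>Splitting by the weight i of the first component gives a finite disjoint union, whose
  cardinality is a Cauchy product.\<close>

lemma graded_sets_Times:
  fixes w :: "'a \<Rightarrow> nat" and v :: "'b \<Rightarrow> nat"
  shows "{x \<in> A \<times> B. w (fst x) + v (snd x) = n} =
    (\<Union>i\<in>{0..n}. {a \<in> A. w a = i} \<times> {b \<in> B. v b = n - i})"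
  by auto

lemma graded_finite_Times:
  assumes "graded_finite A w" and "graded_finite B v"
  shows "graded_finite (A \<times> B) (\<lambda>x. w (fst x) + v (snd x))"
  using assms unfolding graded_finite_def graded_sets_Times by auto

lemma gen_fun_Times:
  assumes "graded_finite A w" and "graded_finite B v"
  shows "gen_fun (A \<times> B) (\<lambda>x. w (fst x) + v (snd x)) = gen_fun A w * gen_fun B v"
proof (rule fps_ext)
  fix n
  have "card {x \<in> A \<times> B. w (fst x) + v (snd x) = n} =
      (\<Sum>i=0..n. card ({a \<in> A. w a = i} \<times> {b \<in> B. v b = n - i}))"
    unfolding graded_sets_Times using assms
    by (intro card_UN_disjoint) (auto simp: graded_finite_def)
  then show "gen_fun (A \<times> B) (\<lambda>x. w (fst x) + v (snd x)) $ n = 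
      (gen_fun A w * gen_fun B v) $ n"
    by (simp add: fps_mult_nth card_cartesian_product)
qed

section \<open>Compositions\<close>

abbreviation compositions :: "nat list set" where
  "compositions \<equiv> {c. \<forall>x\<in>set c. 0 < x}"

lemma length_le_sum_list: "c \<in> compositions \<Longrightarrow> length c \<le> sum_list c"
  by (induction c) auto

lemma graded_finite_compositions: "graded_finite compositions sum_list"
  unfolding graded_finite_def
proof
  fix n
  have "{c \<in> compositions. sum_list c = n} \<subseteq> {c. set c \<subseteq> {..n} \<and> length c \<le> n}"
    using length_le_sum_list by (auto intro: member_le_sum_list)
  then show "finite {c \<in> compositions. sum_list c = n}"
    by (rule finite_subset) (simp add: finite_lists_length_le)
qed

text \<open>A composition is empty or a first part followed by a composition, so C = 1 + P C with P
  = x / (1 - x); the denominators are cleared.\<close>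

lemma gen_fun_compositions:
  "gen_fun compositions sum_list * (1 - 2 * fps_X) = 1 - fps_X"
proof -
  let ?C = "gen_fun compositions sum_list" and ?P = "gen_fun {0<..} (\<lambda>x. x)"
  have singl: "{a. 0 < a \<and> a = n} = (if n = 0 then {} else {n})" for n :: nat
    by auto
  have P: "?P * (1 - fps_X) = fps_X"
  proof (rule fps_ext)
    fix n show "(?P * (1 - fps_X)) $ n = fps_X $ n"
      by (cases n) (auto simp: singl right_diff_distrib fps_X_nth)
  qed
  have finP: "graded_finite {0<..} (\<lambda>x::nat. x)"
    by (simp add: graded_finite_def singl)
  have fin: "graded_finite ({0<..} \<times> compositions) (\<lambda>x. fst x + sum_list (snd x))"
    using graded_finite_Times[OF finP graded_finite_compositions] by simp
  let ?f = "\<lambda>x. fst x # snd x :: nat list"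
  have eq: "compositions = {[]} \<union> ?f ` ({0<..} \<times> compositions)"
  proof (intro equalityI subsetI)
    fix c :: "nat list" assume "c \<in> compositions"
    then show "c \<in> {[]} \<union> ?f ` ({0<..} \<times> compositions)"
      by (cases c) (auto intro!: image_eqI[of _ ?f "(hd c, tl c)"])
  qed auto
  have "?C = gen_fun {[]} sum_list + gen_fun (?f ` ({0<..} \<times> compositions)) sum_list"
    by (subst eq, rule gen_fun_Un)
      (auto simp: graded_finite_def intro!: graded_finite_image[OF fin, unfolded graded_finite_def, rule_format])
  also have "gen_fun (?f ` ({0<..} \<times> compositions)) sum_list = ?P * ?C"
    by (subst gen_fun_image[where v = "\<lambda>x. fst x + sum_list (snd x)"])
      (auto simp: inj_on_def gen_fun_Times[OF finP graded_finite_compositions])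
  also have "gen_fun {[]} sum_list = (1 :: rat fps)"
    by (rule gen_fun_singleton) simp
  finally have C: "?C = 1 + ?P * ?C" .
  have "?C * (1 - fps_X) = (1 + ?P * ?C) * (1 - fps_X)"
    by (rule arg_cong[OF C])
  also have "\<dots> = (1 - fps_X) + ?P * (1 - fps_X) * ?C"
    by (simp only: distrib_left distrib_right mult_1 mult_1_right mult_ac)
  finally show ?thesis
    unfolding P by (simp add: algebra_simps)
qed

definition tuples :: "nat \<Rightarrow> nat list list set" where
  "tuples k = {t. length t = k \<and> (\<forall>c\<in>set t. c \<in> compositions)}"

lemma composition_tuples_altdef:
  "composition_tuples k n = {t \<in> tuples k. sum_list (map sum_list t) = n}"
  by (auto simp: composition_tuples_def tuples_def is_composition_def)

text \<open>One induction carries finiteness and the series together, because the product rule for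
  the series asks for finite levels of the tail.\<close>

lemma gen_fun_tuples:
  "graded_finite (tuples k) (\<lambda>t. sum_list (map sum_list t)) \<and>
   gen_fun (tuples k) (\<lambda>t. sum_list (map sum_list t)) = gen_fun compositions sum_list ^ k"
    (is "graded_finite _ ?w \<and> _")
proof (induction k)
  case 0
  have "tuples 0 = {[]}"
    by (auto simp: tuples_def)
  then show ?case
    by (simp add: gen_fun_singleton graded_finite_def)
next
  case (Suc k)
  let ?f = "\<lambda>x. fst x # snd x :: nat list list"
  have eq: "tuples (Suc k) = ?f ` (compositions \<times> tuples k)"
  proof (intro equalityI subsetI)
    fix t assume "t \<in> tuples (Suc k)"
    then show "t \<in> ?f ` (compositions \<times> tuples k)"
      by (cases t) (auto simp: tuples_def intro!: image_eqI[of _ ?f "(hd t, tl t)"])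
  qed (auto simp: tuples_def)
  note fin = graded_finite_compositions conjunct1[OF Suc.IH]
  show ?case
    unfolding eq
  proof
    show "graded_finite (?f ` (compositions \<times> tuples k)) ?w"
      using graded_finite_Times[OF fin] by (rule graded_finite_image) simp
    show "gen_fun (?f ` (compositions \<times> tuples k)) ?w = gen_fun compositions sum_list ^ Suc k"
      using Suc.IH
      by (subst gen_fun_image[where v = "\<lambda>x. sum_list (fst x) + ?w (snd x)"])
        (auto simp: inj_on_def gen_fun_Times[OF fin])
  qed
qed

section \<open>Paths started at arbitrary height\<close>

lemma ordinate_0 [simp]: "ordinate p 0 = 0"
  by (simp add: ordinate_def)

lemma ordinate_Cons_Suc [simp]: "ordinate (s # p) (Suc i) = step_dy s + ordinate p i"
  by (simp add: ordinate_def)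

text \<open>The free start height makes the predicate recursive along the list of steps.
  \<open>Q\<close> covers two uses: ordinates at least 0 for Schroeder paths, and ordinates between
  0 and 2 for Dyck paths of height at most 2.\<close>

definition path_within :: "(int \<Rightarrow> bool) \<Rightarrow> int \<Rightarrow> step list \<Rightarrow> bool" where
  "path_within Q h p \<longleftrightarrow>
     (\<forall>i\<le>length p. Q (h + ordinate p i)) \<and> h + ordinate p (length p) = 0"

lemma all_le_Suc_iff: "(\<forall>i\<le>Suc n. P i) \<longleftrightarrow> P 0 \<and> (\<forall>i\<le>n. P (Suc i))"
  by (metis Suc_le_mono le0 not0_implies_Suc)

lemma path_within_simps [simp]:
  "path_within Q h [] \<longleftrightarrow> Q h \<and> h = 0"
  "path_within Q h (s # p) \<longleftrightarrow> Q h \<and> path_within Q (h + step_dy s) p"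
  by (auto simp: path_within_def all_le_Suc_iff add.assoc)

definition no_ground_level :: "int \<Rightarrow> step list \<Rightarrow> bool" where
  "no_ground_level h p \<longleftrightarrow> (\<forall>i<length p. p ! i = H2 \<longrightarrow> h + ordinate p i \<noteq> 0)"

lemma no_ground_level_simps [simp]:
  "no_ground_level h []"
  "no_ground_level h (s # p) \<longleftrightarrow> (s = H2 \<longrightarrow> h \<noteq> 0) \<and> no_ground_level (h + step_dy s) p"
  by (auto simp: no_ground_level_def All_less_Suc2 add.assoc)

section \<open>Schroeder paths\<close>

text \<open>The first-return decomposition as a tree: in \<open>Arch a b\<close> the path
  \<open>a\<close> ends just before the first return and \<open>b\<close> follows it. Each large
  Schroeder path has exactly one tree, which makes counting structural.\<close>

datatype schroeder = Empty | Level schroeder | Arch schroeder schroeder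

primrec steps :: "schroeder \<Rightarrow> step list" where
  "steps Empty = []"
| "steps (Level a) = H2 # steps a"
| "steps (Arch a b) = U # steps a @ D # steps b"

primrec semilength :: "schroeder \<Rightarrow> nat" where
  "semilength Empty = 0"
| "semilength (Level a) = Suc (semilength a)"
| "semilength (Arch a b) = Suc (semilength a + semilength b)"

text \<open>Inside \<open>Arch a b\<close> the path \<open>a\<close> runs at height at least 1, so
  its level steps are unrestricted.\<close>

primrec little :: "schroeder \<Rightarrow> bool" where
  "little Empty = True"
| "little (Level a) = False"
| "little (Arch a b) = little b"

text \<open>The remainders \<open>p\<close> and \<open>q\<close> let the induction pass through the first factor of an arch.\<close>
lemma steps_append_cancel:
  assumes "steps a @ p = steps b @ q" and "p = [] \<or> hd p = D" and "q = [] \<or> hd q = D"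
  shows "a = b \<and> p = q"
  using assms
proof (induction a arbitrary: b p q)
  case Empty
  then show ?case by (cases b) auto
next
  case (Level a)
  from Level.prems obtain c where b: "b = Level c"
    by (cases b; cases q) simp_all
  have "a = c \<and> p = q"
    using Level.prems b by (intro Level.IH) simp_all
  then show ?case using b by simp
next
  case (Arch a1 a2)
  from Arch.prems obtain b1 b2 where b: "b = Arch b1 b2"
    by (cases b; cases q) simp_all
  have "a1 = b1 \<and> D # steps a2 @ p = D # steps b2 @ q"
    using Arch.prems b by (intro Arch.IH) auto
  moreover from this have "a2 = b2 \<and> p = q"
    using Arch.prems by (intro Arch.IH) auto
  ultimately show ?case using b by simp
qed

lemma inj_steps: "inj steps"
  using steps_append_cancel[of _ "[]" _ "[]"] by (auto simp: inj_on_def)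

lemma path_within_steps_append:
  "0 \<le> h \<Longrightarrow> path_within ((\<le>) 0) h (steps a @ p) \<longleftrightarrow> path_within ((\<le>) 0) h p"
proof (induction a arbitrary: h p)
  case Empty
  then show ?case by simp
next
  case (Level a)
  then show ?case by simp
next
  case (Arch a b)
  then show ?case by (simp add: Arch.IH)
qed

lemma no_ground_level_steps_append:
  "0 \<le> h \<Longrightarrow> no_ground_level h (steps a @ p) \<longleftrightarrow> (h = 0 \<longrightarrow> little a) \<and> no_ground_level h p"
proof (induction a arbitrary: h p)
  case (Arch a b)
  then show ?case by (simp add: Arch.IH)
qed auto

fun forest_steps :: "schroeder list \<Rightarrow> step list" where
  "forest_steps [] = []"
| "forest_steps [a] = steps a"
| "forest_steps (a # b # as) = steps a @ D # forest_steps (b # as)"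

text \<open>Reading a path that starts at height \<open>h\<close> leaves a stack of \<open>h + 1\<close> Schroeder paths, separated by
  the last descents to each lower height.\<close>
lemma path_within_imp_forest_steps:
  assumes "path_within ((\<le>) 0) (int h) p"
  shows "\<exists>as. length as = Suc h \<and> p = forest_steps as"
  using assms
proof (induction p arbitrary: h)
  case Nil
  then have "length [Empty] = Suc h \<and> [] = forest_steps [Empty]"
    by simp
  then show ?case by blast
next
  case (Cons s p)
  show ?case
  proof (cases s)
    case U
    with Cons.prems Cons.IH[of "Suc h"] obtain as
      where "length as = Suc (Suc h)" "p = forest_steps as"
      by (auto simp: algebra_simps)
    then obtain a b bs where "as = a # b # bs" "length bs = h" "p = forest_steps (a # b # bs)"
      by (auto simp: length_Suc_conv)
    \<comment> \<open>The new U and the D separating \<open>a\<close> from \<open>b\<close> enclose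
      \<open>a\<close>, which merges the two top entries of the stack.\<close>
    then have "length (Arch a b # bs) = Suc h \<and> s # p = forest_steps (Arch a b # bs)"
      using U by (cases bs) auto
    then show ?thesis by blast
  next
    case D
    have "0 \<le> int h - 1"
      using Cons.prems D by (cases p) auto
    then obtain k where k: "h = Suc k"
      by (cases h) auto
    with Cons.prems Cons.IH[of k] D obtain as
      where "length as = Suc k" "p = forest_steps as"
      by auto
    \<comment> \<open>The path leaves its current level at once, so an empty path is pushed on
      top.\<close>
    then have "length (Empty # as) = Suc h \<and> s # p = forest_steps (Empty # as)"
      using k D by (cases as) auto
    then show ?thesis by blast
  next
    case H2
    with Cons.prems Cons.IH[of h] obtain as where "length as = Suc h" "p = forest_steps as"
      by auto
    then obtain a bs where "length bs = h" "p = forest_steps (a # bs)"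
      by (auto simp: length_Suc_conv)
    then have "length (Level a # bs) = Suc h \<and> s # p = forest_steps (Level a # bs)"
      using H2 by (cases bs) auto
    then show ?thesis by blast
  qed
qed

lemma range_steps: "range steps = {p. path_within ((\<le>) 0) 0 p}"
proof (intro equalityI subsetI)
  fix p assume "p \<in> {p. path_within ((\<le>) 0) 0 p}"
  then obtain as where "length as = Suc 0" "p = forest_steps as"
    using path_within_imp_forest_steps[of 0 p] by auto
  then show "p \<in> range steps"
    by (auto simp: length_Suc_conv)
next
  fix p assume "p \<in> range steps"
  then show "p \<in> {p. path_within ((\<le>) 0) 0 p}"
    using path_within_steps_append[of 0 _ "[]"] by auto
qed

lemma abscissa_steps: "abscissa (steps a) (length (steps a)) = 2 * int (semilength a)"
proof -
  have "sum_list (map step_dx (steps a)) = 2 * int (semilength a)"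
    by (induction a) auto
  then show ?thesis by (simp add: abscissa_def)
qed

lemma little_schroeder_paths_eq:
  "little_schroeder_paths n = steps ` {a \<in> {a. little a}. semilength a = n}"
proof -
  have "little_schroeder_paths n =
      {p \<in> range steps. no_ground_level 0 p \<and> abscissa p (length p) = 2 * int n}"
    unfolding range_steps
    by (auto simp: little_schroeder_paths_def weakly_above_axis_def path_within_def
        no_ground_level_def)
  also have "\<dots> = steps ` {a \<in> {a. little a}. semilength a = n}"
    using no_ground_level_steps_append[of 0 _ "[]"] by (auto simp: abscissa_steps)
  finally show ?thesis .
qed

lemma little_schroeder_number_eq:
  "little_schroeder_number n = card {a \<in> {a. little a}. semilength a = n}"
  unfolding little_schroeder_number_def little_schroeder_paths_eq
  by (rule card_image) (rule inj_on_subset[OF inj_steps], simp)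

section \<open>Dyck paths of height at most two\<close>

definition zigzag :: "nat \<Rightarrow> step list" where
  "zigzag k = concat (replicate k [U, D])"

lemma zigzag_simps [simp]: "zigzag 0 = []" "zigzag (Suc k) = U # D # zigzag k"
  by (simp_all add: zigzag_def)

primrec hills :: "nat list \<Rightarrow> step list" where
  "hills [] = []"
| "hills (k # ks) = U # zigzag k @ D # hills ks"

abbreviation low_path :: "int \<Rightarrow> step list \<Rightarrow> bool" where
  "low_path h p \<equiv> path_within (\<lambda>y. 0 \<le> y \<and> y \<le> 2) h p \<and> set p \<subseteq> {U, D}"

text \<open>Each further round of a zigzag begins with U whereas the closing step is D, so the end
  of the zigzag is recognised and decoding is unique.\<close>

lemma zigzag_append_cancel:
  "zigzag k @ D # p = zigzag l @ D # q \<longleftrightarrow> k = l \<and> p = q"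
proof (induction k arbitrary: l)
  case 0
  then show ?case by (cases l) auto
next
  case (Suc k)
  then show ?case by (cases l) auto
qed

lemma inj_hills: "inj hills"
proof
  fix ks ls assume "hills ks = hills ls"
  then show "ks = ls"
  proof (induction ks arbitrary: ls)
    case Nil
    then show ?case by (cases ls) auto
  next
    case (Cons k ks)
    then show ?case by (cases ls) (auto simp: zigzag_append_cancel)
  qed
qed

lemma path_within_zigzag_append:
  "path_within (\<lambda>y. 0 \<le> y \<and> y \<le> 2) 1 (zigzag k @ p) \<longleftrightarrow> path_within (\<lambda>y. 0 \<le> y \<and> y \<le> 2) 1 p"
  by (induction k) simp_all

lemma low_path_hills: "low_path 0 (hills ks)"
proof (induction ks)
  case (Cons k ks)
  have "set (zigzag k) \<subseteq> {U, D}"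
    by (auto simp: zigzag_def)
  with Cons show ?case by (auto simp: path_within_zigzag_append)
qed simp

text \<open>Reading step by step passes through the heights 0, 1 and 2, so the three claims are
  proved together. A path from height 1 or 2 begins with the unread rest of a component, cut at
  height 1 or after the U of an inner U D.\<close>

lemma low_path_imp_hills:
  "(low_path 0 p \<longrightarrow> (\<exists>ks. p = hills ks)) \<and>
   (low_path 1 p \<longrightarrow> (\<exists>k ks. p = zigzag k @ D # hills ks)) \<and>
   (low_path 2 p \<longrightarrow> (\<exists>k ks. p = D # zigzag k @ D # hills ks))"
proof (induction p)
  case Nil
  have "[] = hills []"
    by simp
  then have "\<exists>ks. [] = hills ks"
    by blast
  then show ?case by simp
next
  case (Cons s p)
  \<comment> \<open>The heights -1 and 3 lie outside the strip, which excludes D from height 0 and U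
    from height 2.\<close>
  have neg: "\<not> path_within (\<lambda>y. 0 \<le> y \<and> y \<le> 2) (-1) p" "\<not> path_within (\<lambda>y. 0 \<le> y \<and> y \<le> 2) 3 p"
    by (cases p; simp)+
  have 0: "\<exists>ks. s # p = hills ks" if "low_path 0 (s # p)"
  proof -
    from that neg have "s = U" and p: "low_path 1 p"
      by (cases s; auto)+
    moreover from p Cons.IH obtain k ks where "p = zigzag k @ D # hills ks"
      by blast
    ultimately have "s # p = hills (k # ks)"
      by simp
    then show ?thesis by blast
  qed
  have 1: "\<exists>k ks. s # p = zigzag k @ D # hills ks" if "low_path 1 (s # p)"
  proof (cases s)
    case U
    with that have "low_path 2 p"
      by auto
    with Cons.IH obtain k ks where "p = D # zigzag k @ D # hills ks"
      by blast
    with U have "s # p = zigzag (Suc k) @ D # hills ks"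
      by simp
    then show ?thesis by blast
  next
    case D
    with that have "low_path 0 p"
      by auto
    with Cons.IH obtain ks where "p = hills ks"
      by blast
    with D have "s # p = zigzag 0 @ D # hills ks"
      by simp
    then show ?thesis by blast
  next
    case H2
    with that show ?thesis by auto
  qed
  have 2: "\<exists>k ks. s # p = D # zigzag k @ D # hills ks" if "low_path 2 (s # p)"
  proof -
    from that neg have "s = D" and p: "low_path 1 p"
      by (cases s; auto)+
    moreover from p Cons.IH obtain k ks where "p = zigzag k @ D # hills ks"
      by blast
    ultimately have "s # p = D # zigzag k @ D # hills ks"
      by simp
    then show ?thesis by blast
  qed
  from 0 1 2 show ?case by blast
qed

lemma range_hills: "range hills = {p. low_path 0 p}"
  using low_path_imp_hills low_path_hills by blast

section \<open>Counting the peaks of each height\<close>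

definition peaks_from :: "int \<Rightarrow> int \<Rightarrow> step list \<Rightarrow> nat set" where
  "peaks_from h t p =
     {i. Suc i < length p \<and> p ! i = U \<and> p ! Suc i = D \<and> h + ordinate p (Suc i) = t}"

lemma finite_peaks_from: "finite (peaks_from h t p)"
  by (rule finite_subset[of _ "{..<length p}"]) (auto simp: peaks_from_def)

text \<open>Whether a leading U is a peak depends on the next step, hence the test on
  \<open>hd p\<close>; all other peaks are those of \<open>p\<close> with index shifted by
  one.\<close>

lemma card_peaks_from_simps [simp]:
  "card (peaks_from h t []) = 0"
  "card (peaks_from h t (s # p)) =
     (if s = U \<and> p \<noteq> [] \<and> hd p = D \<and> h + 1 = t then 1 else 0) + card (peaks_from (h + step_dy s) t p)"
proof -
  show "card (peaks_from h t []) = 0"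
    by (simp add: peaks_from_def)
  let ?first = "if s = U \<and> p \<noteq> [] \<and> hd p = D \<and> h + 1 = t then {0} else {} :: nat set"
  have "i \<in> peaks_from h t (s # p) \<longleftrightarrow> i \<in> ?first \<union> Suc ` peaks_from (h + step_dy s) t p" for i
    by (cases i; cases p) (auto simp: peaks_from_def add.assoc)
  then have "peaks_from h t (s # p) = ?first \<union> Suc ` peaks_from (h + step_dy s) t p"
    by blast
  then show "card (peaks_from h t (s # p)) =
      (if s = U \<and> p \<noteq> [] \<and> hd p = D \<and> h + 1 = t then 1 else 0) + card (peaks_from (h + step_dy s) t p)"
    by (simp add: card_image finite_peaks_from)
qed

lemma card_peaks_from_zigzag:
  "card (peaks_from 1 t (zigzag k @ D # p)) = (if t = 2 then k else 0) + card (peaks_from 0 t p)"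
  by (induction k) auto

text \<open>The opening U of a component is a peak exactly when its zigzag is empty, so each zero
  gives one peak of height 1. The k inner U D start at height 1 and give the peaks of height
  2.\<close>

lemma card_peaks_hills:
  "card (peaks_at 1 (hills ks)) = count_list ks 0"
  "card (peaks_at 2 (hills ks)) = sum_list ks"
proof -
  have "card (peaks_from 0 1 (hills ks)) = count_list ks 0"
       "card (peaks_from 0 2 (hills ks)) = sum_list ks"
  proof (induction ks)
    case (Cons k ks)
    {
      case 1
      show ?case using Cons by (cases k) (auto simp: card_peaks_from_zigzag)
    next
      case 2
      show ?case using Cons by (cases k) (auto simp: card_peaks_from_zigzag)
    }
  qed auto
  then show "card (peaks_at 1 (hills ks)) = count_list ks 0"
    and "card (peaks_at 2 (hills ks)) = sum_list ks"
    by (simp_all add: peaks_from_def peaks_at_def)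
qed

lemma dyck_path_le_2_iff: "dyck_path p \<and> path_height p \<le> 2 \<longleftrightarrow> low_path 0 p"
  by (auto simp: dyck_path_def weakly_above_axis_def path_height_def path_within_def)

lemma path_height_ge_2:
  assumes "peaks_at 2 p \<noteq> {}"
  shows "2 \<le> path_height p"
proof -
  from assms obtain i where "Suc i < length p" "ordinate p (Suc i) = 2"
    by (auto simp: peaks_at_def)
  then have "2 \<in> ordinate p ` {..length p}"
    by (metis atMost_iff imageI less_imp_le)
  then show ?thesis
    by (simp add: path_height_def)
qed

lemma dyck_paths_height2_eq:
  assumes "1 \<le> r"
  shows "dyck_paths_height2 r = hills ` {ks. count_list ks 0 = r \<and> sum_list ks = r}"
proof -
  \<comment> \<open>Since r is positive, a peak of height 2 exists and forces the height to be at
    least 2; only the upper bound remains as a condition.\<close>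
  have "path_height p = 2 \<longleftrightarrow> path_height p \<le> 2" if "card (peaks_at 2 p) = r" for p
    using assms that path_height_ge_2[of p] by (cases "peaks_at 2 p = {}") auto
  then have "dyck_paths_height2 r =
      {p. low_path 0 p \<and> card (peaks_at 1 p) = r \<and> card (peaks_at 2 p) = r}"
    unfolding dyck_path_le_2_iff[symmetric] dyck_paths_height2_def by blast
  also have "\<dots> = {p \<in> range hills. card (peaks_at 1 p) = r \<and> card (peaks_at 2 p) = r}"
    unfolding range_hills by blast
  also have "\<dots> = hills ` {ks. count_list ks 0 = r \<and> sum_list ks = r}"
    by (auto simp: card_peaks_hills)
  finally show ?thesis .
qed

section \<open>Splitting at zeros\<close>

text \<open>A word with z zeros has z + 1 blocks, some possibly empty, so even the empty word yields
  one block. Hence \<open>hd\<close> and \<open>tl\<close> never meet the empty list.\<close>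

fun split_zeros :: "nat list \<Rightarrow> nat list list" where
  "split_zeros [] = [[]]"
| "split_zeros (0 # w) = [] # split_zeros w"
| "split_zeros (Suc k # w) = (Suc k # hd (split_zeros w)) # tl (split_zeros w)"

fun join_zeros :: "nat list list \<Rightarrow> nat list" where
  "join_zeros [] = []"
| "join_zeros [c] = c"
| "join_zeros (c # d # t) = c @ 0 # join_zeros (d # t)"

lemma split_zeros_nonempty [simp]: "split_zeros w \<noteq> []"
  by (cases w rule: split_zeros.cases) simp_all

lemma join_split_zeros: "join_zeros (split_zeros w) = w"
proof (induction w rule: split_zeros.induct)
  case (2 w)
  then show ?case by (cases "split_zeros w") simp_all
next
  case (3 k w)
  obtain c t where "split_zeros w = c # t"
    by (cases "split_zeros w") auto
  with 3 show ?case by (cases t) simp_all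
qed simp

lemma split_zeros_append:
  "c \<in> compositions \<Longrightarrow> split_zeros (c @ w) = (c @ hd (split_zeros w)) # tl (split_zeros w)"
proof (induction c)
  case (Cons x c)
  then show ?case by (cases x) simp_all
qed simp

text \<open>A zero inside an entry would be read as a separator, and \<open>join_zeros\<close> sends
  both \<open>[]\<close> and \<open>[[]]\<close> to the empty word; the hypotheses exclude these two
  collisions.\<close>

lemma split_join_zeros:
  "t \<noteq> [] \<Longrightarrow> \<forall>c\<in>set t. c \<in> compositions \<Longrightarrow> split_zeros (join_zeros t) = t"
proof (induction t rule: join_zeros.induct)
  case (2 c)
  then show ?case using split_zeros_append[of c "[]"] by simp
next
  case (3 c d t)
  then show ?case using split_zeros_append[of c "0 # join_zeros (d # t)"] by simp
qed simp

lemma split_zeros_in_tuples: "split_zeros w \<in> tuples (Suc (count_list w 0))"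
proof (induction w rule: split_zeros.induct)
  case (3 k w)
  then show ?case by (cases "split_zeros w") (simp_all add: tuples_def)
qed (simp_all add: tuples_def)

lemma sum_list_split_zeros: "sum_list (map sum_list (split_zeros w)) = sum_list w"
proof (induction w rule: split_zeros.induct)
  case (3 k w)
  then show ?case by (cases "split_zeros w") simp_all
qed simp_all

lemma bij_betw_split_zeros:
  "bij_betw split_zeros {w. count_list w 0 = r \<and> sum_list w = n} (composition_tuples (r + 1) n)"
    (is "bij_betw _ ?W ?T")
proof (rule bij_betw_byWitness[where f' = join_zeros])
  have tuple: "split_zeros (join_zeros t) = t" if "t \<in> ?T" for t
    using that by (intro split_join_zeros) (auto simp: composition_tuples_altdef tuples_def)
  then show "\<forall>t\<in>?T. split_zeros (join_zeros t) = t"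
    by blast
  show "\<forall>w\<in>?W. join_zeros (split_zeros w) = w"
    by (simp add: join_split_zeros)
  show "split_zeros ` ?W \<subseteq> ?T"
    using split_zeros_in_tuples
    by (auto simp: composition_tuples_altdef sum_list_split_zeros)
  show "join_zeros ` ?T \<subseteq> ?W"
  proof
    fix w assume "w \<in> join_zeros ` ?T"
    \<comment> \<open>The zeros and the sum of \<open>w\<close> are read off
      \<open>split_zeros w\<close>: its length is one more than the number of zeros, and its total
      sum is that of \<open>w\<close>.\<close>
    then have "split_zeros w \<in> ?T"
      using tuple by auto
    then show "w \<in> ?W"
      using split_zeros_in_tuples[of w] sum_list_split_zeros[of w]
      by (simp add: composition_tuples_altdef tuples_def)
  qed
qed

section \<open>Counting\<close>

lemma graded_finite_semilength: "graded_finite A semilength"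
proof -
  \<comment> \<open>With the bound in place of an exact value, a single set contains both factors of
    an arch.\<close>
  have fin: "finite {a. semilength a \<le> n}" for n
  proof (induction n)
    case 0
    have "a = Empty" if "semilength a \<le> 0" for a
      using that by (cases a) auto
    then have "{a. semilength a \<le> 0} \<subseteq> {Empty}"
      by blast
    then show ?case
      by (rule finite_subset) simp
  next
    case (Suc n)
    let ?F = "{a. semilength a \<le> n}"
    have "a \<in> {Empty} \<union> (Level ` ?F \<union> case_prod Arch ` (?F \<times> ?F))" if "semilength a \<le> Suc n" for a
      using that by (cases a) auto
    then have "{a. semilength a \<le> Suc n} \<subseteq> {Empty} \<union> (Level ` ?F \<union> case_prod Arch ` (?F \<times> ?F))"
      by blast
    then show ?case
      by (rule finite_subset) (simp add: Suc.IH)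
  qed
  show ?thesis
    unfolding graded_finite_def
  proof
    fix n show "finite {a \<in> A. semilength a = n}"
      by (rule finite_subset[OF _ fin[of n]]) auto
  qed
qed

section \<open>Functional equations of the large and little Schroeder series\<close>

lemma gen_fun_Arch:
  "gen_fun (case_prod Arch ` (A \<times> B)) semilength =
     fps_X * (gen_fun A semilength * gen_fun B semilength)"
proof -
  have "gen_fun (case_prod Arch ` (A \<times> B)) semilength =
      gen_fun (A \<times> B) (\<lambda>x. Suc (semilength (fst x) + semilength (snd x)))"
    by (rule gen_fun_image) (auto simp: inj_on_def)
  then show ?thesis
    by (simp only: gen_fun_Suc gen_fun_Times[OF graded_finite_semilength graded_finite_semilength])
qed

lemma gen_fun_schroeder:
  fixes L :: "rat fps"
  defines "L \<equiv> gen_fun UNIV semilength"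
  shows "L = 1 + (fps_X * L + fps_X * (L * L))"
proof -
  have "a \<in> {Empty} \<union> (range Level \<union> case_prod Arch ` (UNIV \<times> UNIV))" for a
    by (cases a) auto
  then have "(UNIV :: schroeder set) = {Empty} \<union> (range Level \<union> case_prod Arch ` (UNIV \<times> UNIV))"
    by blast
  then have "L = gen_fun ({Empty} \<union> (range Level \<union> case_prod Arch ` (UNIV \<times> UNIV))) semilength"
    unfolding L_def by (rule arg_cong)
  also have "\<dots> = gen_fun {Empty} semilength +
      (gen_fun (range Level) semilength + gen_fun (case_prod Arch ` (UNIV \<times> UNIV)) semilength)"
    by (subst gen_fun_Un[OF graded_finite_semilength graded_finite_semilength], fastforce)+ simp
  also have "gen_fun {Empty} semilength = 1"
    by (rule gen_fun_singleton) simp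
  also have "gen_fun (range Level) semilength = gen_fun UNIV (\<lambda>a. Suc (semilength a))"
    by (rule gen_fun_image) (auto simp: inj_on_def)
  finally show ?thesis
    unfolding gen_fun_Arch gen_fun_Suc L_def .
qed

lemma gen_fun_little:
  fixes L S :: "rat fps"
  defines "L \<equiv> gen_fun UNIV semilength" and "S \<equiv> gen_fun {a. little a} semilength"
  shows "S = 1 + fps_X * (L * S)"
proof -
  have "little a \<longleftrightarrow> a \<in> {Empty} \<union> case_prod Arch ` (UNIV \<times> {a. little a})" for a
    by (cases a) auto
  then have "{a. little a} = {Empty} \<union> case_prod Arch ` (UNIV \<times> {a. little a})"
    by blast
  then have "S = gen_fun ({Empty} \<union> case_prod Arch ` (UNIV \<times> {a. little a})) semilength"
    unfolding S_def by (rule arg_cong)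
  also have "\<dots> = gen_fun {Empty} semilength +
      gen_fun (case_prod Arch ` (UNIV \<times> {a. little a})) semilength"
    by (subst gen_fun_Un[OF graded_finite_semilength graded_finite_semilength]) auto
  also have "gen_fun {Empty} semilength = 1"
    by (rule gen_fun_singleton) simp
  finally show ?thesis
    unfolding gen_fun_Arch L_def S_def .
qed

lemma gen_fun_little_compose:
  fixes S :: "rat fps"
  defines "S \<equiv> gen_fun {a. little a} semilength"
  shows "S = fps_compose (gen_fun compositions sum_list) (fps_X * S)"
proof -
  define L where "L = gen_fun UNIV semilength"
  define C where "C = gen_fun compositions sum_list"
  define F where "F = fps_X * S"
  have L: "L = 1 + (fps_X * L + fps_X * (L * L))"
    unfolding L_def by (rule gen_fun_schroeder)
  have S: "S = 1 + fps_X * (L * S)"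
    unfolding L_def S_def by (rule gen_fun_little)
  \<comment> \<open>S is the inverse of 1 - x L, so multiplying by S removes that factor from the
    equation for L without division.\<close>
  have "L * (1 - fps_X * L) = 1 + fps_X * L" and S1: "S * (1 - fps_X * L) = 1"
    using L S by (simp_all add: algebra_simps)
  then have "L = S * (1 + fps_X * L)"
    by (metis mult.assoc mult.commute mult_1)
  also have "\<dots> = S + (S - 1)"
    using S by (simp add: algebra_simps)
  finally have "L = S + (S - 1)" .
  \<comment> \<open>Eliminating L leaves an equation in S alone, which is linear in S once F = x S
    is treated as a coefficient.\<close>
  with S have "S = 1 + fps_X * ((S + (S - 1)) * S)"
    by simp
  then have SF: "S * (1 - (F + F)) = 1 - F"
    by (simp add: F_def algebra_simps)
  have F0: "F $ 0 = 0"
    by (simp add: F_def)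
  have "C * (1 - (fps_X + fps_X)) = 1 - fps_X"
    using gen_fun_compositions by (simp add: C_def)
  \<comment> \<open>Substituting F for x respects products because F has constant term 0; it gives
    \<open>fps_compose C F\<close> the same linear equation as S.\<close>
  then have "fps_compose (C * (1 - (fps_X + fps_X))) F = fps_compose (1 - fps_X) F"
    by (rule arg_cong)
  then have "fps_compose C F * (1 - (F + F)) = 1 - F"
    by (simp add: fps_compose_mult_distrib[OF F0] fps_compose_sub_distrib fps_compose_add_distrib F0)
  with SF have "(S - fps_compose C F) * (1 - (F + F)) = 0"
    by (simp add: left_diff_distrib)
  \<comment> \<open>The common factor has constant term 1, so it is nonzero and cancels in the
    integral domain of rational power series.\<close>
  moreover have "(1 - (F + F)) $ 0 \<noteq> 0"
    using F0 by simp
  then have "1 - (F + F) \<noteq> 0"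
    by (metis fps_zero_nth)
  ultimately show ?thesis
    by (simp add: C_def F_def)
qed

section \<open>Coefficient extraction and the final bijection\<close>

lemma card_composition_tuples:
  "card (composition_tuples (r + 1) r) = (r + 1) * little_schroeder_number r"
proof -
  \<comment> \<open>Lagrange inversion with n = r and k = 1; the exponent n + k is the number r + 1
    of entries of a tuple.\<close>
  have "of_nat (r + 1) * (gen_fun {a. little a} semilength ^ 1 $ r) =
      of_nat 1 * (gen_fun compositions sum_list ^ (r + 1) $ r)"
    by (rule lagrange_inversion) (rule gen_fun_little_compose)
  then have "of_nat (r + 1) * of_nat (little_schroeder_number r) =
      gen_fun (tuples (r + 1)) (\<lambda>t. sum_list (map sum_list t)) $ r"
    by (simp only: conjunct2[OF gen_fun_tuples] little_schroeder_number_eq gen_fun_nth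
        power_one_right of_nat_1 mult_1)
  then have "(of_nat ((r + 1) * little_schroeder_number r) :: rat) =
      of_nat (card (composition_tuples (r + 1) r))"
    by (simp only: of_nat_mult composition_tuples_altdef gen_fun_nth)
  then show ?thesis
    by (simp only: of_nat_eq_iff)
qed

lemma finite_composition_tuples: "finite (composition_tuples k n)"
  using conjunct1[OF gen_fun_tuples]
  unfolding graded_finite_def composition_tuples_altdef by blast

theorem proposition3p6:
  fixes r :: nat
  assumes "r \<ge> 1"
  shows "(\<exists>f. bij_betw f (dyck_paths_height2 r) (composition_tuples (r + 1) r)) \<and>
         finite (dyck_paths_height2 r) \<and>
         card (dyck_paths_height2 r) = (r + 1) * little_schroeder_number r \<and>
         finite (composition_tuples (r + 1) r) \<and>
         card (composition_tuples (r + 1) r) = (r + 1) * little_schroeder_number r"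
proof -
  let ?W = "{w. count_list w 0 = r \<and> sum_list w = r}"
  have "bij_betw hills ?W (dyck_paths_height2 r)"
    unfolding dyck_paths_height2_eq[OF assms]
    by (rule inj_on_imp_bij_betw) (rule inj_on_subset[OF inj_hills], simp)
  \<comment> \<open>Words with r zeros and sum r mediate: a path is decoded to its word, which is
    then cut at the zeros.\<close>
  then have f: "bij_betw (split_zeros \<circ> inv_into ?W hills) (dyck_paths_height2 r)
      (composition_tuples (r + 1) r)"
    by (rule bij_betw_trans[OF bij_betw_inv_into bij_betw_split_zeros])
  have "finite (dyck_paths_height2 r)"
    using bij_betw_finite[OF f] finite_composition_tuples by simp
  moreover have "card (dyck_paths_height2 r) = (r + 1) * little_schroeder_number r"
    using bij_betw_same_card[OF f] by (simp only: card_composition_tuples)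
  ultimately show ?thesis
    using f finite_composition_tuples card_composition_tuples by blast
qed

end
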